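(* Let $F$ be a finite Borel measure on $\mathbb{R}$, identified with its bounded, non-decreasing, right-continuous distribution function $F(x)=F((-\infty,x])$. Let $M(s)=\int_{\mathbb{R}} e^{sx}\,dF(x)$, and define $q^*,r^*$ by $-q^*=\inf\{s\in\mathbb{R}:M(s)<\infty\}$ and $r^*=\sup\{s\in\mathbb{R}:M(s)<\infty\}$. Assume $q^*,r^*\in(0,\infty)$. (i) If $\log M(-q^*+s)\sim s^{-\rho}\,l_1(1/s)$ as $s\to0+$ for some $\rho>0$ and some $l_1\in R_0$, then $$\log F((-\infty,-x])\sim -q^* x\quad\text{as }x\to\infty .$$ (ii) If $\log M(r^*-s)\sim s^{-\rho}\,l_1(1/s)$ as $s\to0+$ for some $\rho>0$ and some $l_1\in R_0$, then $$\log F((x,\infty))\sim -r^* x\quad\text{as }x\to\infty .$$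
   Context: $R_0$ denotes the class of functions slowly varying at infinity: positive measurable functions $l$, defined on a neighbourhood of $+\infty$, with $l(\lambda x)/l(x)\to1$ as $x\to\infty$ for every $\lambda>0$. $g\sim h$ means that the ratio $g/h$ tends to $1$ in the indicated limit. *)

theory Defs
  imports "HOL-Probability.Probability" "HOL-Library.Landau_Symbols"
begin

(* "Measurable" is taken in the Lebesgue sense, which includes the Borel case. Values of l
   below A are unconstrained, so l is in effect only defined on a neighbourhood of infinity. *)
definition slowly_varying :: "(real \<Rightarrow> real) \<Rightarrow> bool" where
  "slowly_varying l \<longleftrightarrow>
     (\<exists>A. l \<in> borel_measurable (lebesgue_on {A..}) \<and> (\<forall>x\<ge>A. l x > 0)) \<and>
     (\<forall>c>0. ((\<lambda>x. l (c * x) / l x) \<longlongrightarrow> 1) at_top)"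

(* Extended-valued, so that the condition M(s) < infinity is meaningful (a divergent
   Bochner integral would be 0). *)
definition mgf :: "real measure \<Rightarrow> real \<Rightarrow> ennreal" where
  "mgf F s = (\<integral>\<^sup>+ x. ennreal (exp (s * x)) \<partial>F)"

(* The infimum and supremum are taken in the extended reals, where they always exist. *)
definition q_star :: "real measure \<Rightarrow> ereal" where
  "q_star F = - (INF s\<in>{s. mgf F s < \<infinity>}. ereal s)"

definition r_star :: "real measure \<Rightarrow> ereal" where
  "r_star F = (SUP s\<in>{s. mgf F s < \<infinity>}. ereal s)"

end

theory Submission
  imports Defs
begin

text \<open>
  Part (i) is part (ii) for the reflected measure. In part (ii) write
  \<open>\<phi> s = ln M(r\<^sup>* - s)\<close>. The upper bound is Chernoff's. For the lower bound, tilt \<open>F\<close> by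
  \<open>exp ((r\<^sup>* - s) x)\<close>; changing the tilt by \<open>\<plusminus> \<theta> s\<close> and using regular variation of \<open>\<phi>\<close>, the
  tilted measure of the complement of \<open>(\<alpha> \<phi>(s)/s, \<beta> \<phi>(s)/s]\<close> is at most one half when
  \<open>\<alpha> < \<rho> < \<beta>\<close>. Choosing \<open>s\<close> with \<open>\<alpha> \<phi>(s)/s = x\<close>, possible because \<open>M\<close> is convex and hence
  continuous, yields \<open>F((x,\<infinity>)) \<ge> exp (- r\<^sup>* (\<beta>/\<alpha>) x)\<close>.
\<close>

section \<open>Real analysis near 0: regular variation, blow-up and the size of the tilt\<close>

text \<open>Up to factors tending to 1, the quotient is \<open>c powr (- \<rho>)\<close> times the
  quotient of \<open>l\<close> at \<open>1 / (c * s)\<close> and \<open>1 / s\<close>, which slow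
  variation sends to 1. The sign of \<open>\<phi>\<close> is inherited from
  \<open>l\<close>.\<close>

lemma slowly_varying_asymp_ratio:
  assumes l: "slowly_varying l" and c: "c > 0"
    and asymp: "\<phi> \<sim>[at_right 0] (\<lambda>s. s powr (- \<rho>) * l (1 / s))"
  shows "((\<lambda>s. \<phi> (c * s) / \<phi> s) \<longlongrightarrow> c powr (- \<rho>)) (at_right 0)"
    and "eventually (\<lambda>s. \<phi> s > 0) (at_right 0)"
proof -
  define g where "g s = s powr (- \<rho>) * l (1 / s)" for s :: real
  obtain A where A: "\<And>x. x \<ge> A \<Longrightarrow> l x > 0"
    using l unfolding slowly_varying_def by blast
  have inv: "filterlim (\<lambda>s::real. 1 / s) at_top (at_right 0)"
    using filterlim_inverse_at_top_right by (simp add: inverse_eq_divide)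
  have pos: "eventually (\<lambda>s::real. s > 0) (at_right 0)"
    by (rule eventually_at_right_less)
  have g_pos: "eventually (\<lambda>s. g s > 0) (at_right 0)"
    using inv[unfolded filterlim_at_top, rule_format, of A] pos
    by eventually_elim (simp add: g_def A)
  \<comment> \<open>Asymptotic equivalence counts the quotient as 1 where both sides vanish;
    positivity of \<open>g\<close> makes it a genuine limit of quotients.\<close>
  have ratio: "((\<lambda>s. \<phi> s / g s) \<longlongrightarrow> 1) (at_right 0)"
    by (rule asymp_equivD_strong)
      (use asymp g_pos in \<open>auto simp: g_def elim: eventually_mono\<close>)
  have "eventually (\<lambda>s. \<phi> s / g s > 0) (at_right 0)"
    using order_tendstoD(1)[OF ratio, of 0] by simp
  with g_pos show phi_pos: "eventually (\<lambda>s. \<phi> s > 0) (at_right 0)"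
    by eventually_elim (simp add: zero_less_divide_iff)
  have lim_c: "filterlim (\<lambda>s. c * s) (at_right 0) (at_right 0)"
    unfolding filterlim_at
  proof
    have "((\<lambda>s. c * s) \<longlongrightarrow> c * 0) (at_right 0)"
      by (intro tendsto_intros)
    then show "((\<lambda>s. c * s) \<longlongrightarrow> 0) (at_right 0)" by simp
    show "eventually (\<lambda>s. c * s \<in> {0<..} \<and> c * s \<noteq> 0) (at_right 0)"
      using pos by eventually_elim (use c in auto)
  qed
  have "((\<lambda>x. l ((1 / c) * x) / l x) \<longlongrightarrow> 1) at_top"
    using l c zero_less_divide_1_iff[of c] unfolding slowly_varying_def by blast
  from filterlim_compose[OF this inv]
  have l_ratio: "((\<lambda>s. l (1 / c * (1 / s)) / l (1 / s)) \<longlongrightarrow> 1) (at_right 0)" .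
  have lim: "((\<lambda>s. (\<phi> (c * s) / g (c * s)) * (c powr (- \<rho>) * (l (1 / c * (1 / s)) / l (1 / s)))
        / (\<phi> s / g s)) \<longlongrightarrow> 1 * (c powr (- \<rho>) * 1) / 1) (at_right 0)"
    by (intro tendsto_intros filterlim_compose[OF ratio lim_c] ratio l_ratio) simp
  have "eventually (\<lambda>s. (\<phi> (c * s) / g (c * s)) * (c powr (- \<rho>) * (l (1 / c * (1 / s)) / l (1 / s)))
        / (\<phi> s / g s) = \<phi> (c * s) / \<phi> s) (at_right 0)"
    using pos g_pos phi_pos eventually_compose_filterlim[OF g_pos lim_c]
  proof eventually_elim
    case (elim s)
    have "g (c * s) = c powr (- \<rho>) * s powr (- \<rho>) * l (1 / c * (1 / s))"
      using elim c by (simp add: g_def powr_mult)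
    then show ?case
      using elim c by (auto simp: g_def field_simps)
  qed
  from Lim_transform_eventually[OF lim this]
  show "((\<lambda>s. \<phi> (c * s) / \<phi> s) \<longlongrightarrow> c powr (- \<rho>)) (at_right 0)" by simp
qed

text \<open>The doubling ratio makes \<open>\<phi>\<close> blow up along a geometric sequence; convexity of
  \<open>exp \<circ> \<phi>\<close> fills the gaps.\<close>

lemma filterlim_at_top_convex_doubling:
  fixes f \<phi> :: "real \<Rightarrow> real"
  assumes conv: "convex_on {0<..<d} f" and d: "d > 0"
    and f: "eventually (\<lambda>s. f s = exp (\<phi> s)) (at_right 0)"
    and pos: "eventually (\<lambda>s. \<phi> s > 0) (at_right 0)"
    and ratio: "((\<lambda>s. \<phi> (1/2 * s) / \<phi> s) \<longlongrightarrow> k) (at_right 0)" and k: "k > 1"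
  shows "filterlim \<phi> at_top (at_right 0)"
proof -
  \<comment> \<open>Leaving room below the limit \<open>k\<close> gives one growth factor
    \<open>k'\<close> valid for every halving of a small enough \<open>s\<close>.\<close>
  obtain k' where k': "1 < k'" "k' < k" using dense[OF k] by blast
  have "eventually (\<lambda>s. f s = exp (\<phi> s) \<and> \<phi> s > 0 \<and> \<phi> (1/2 * s) / \<phi> s > k' \<and> s \<in> {0<..<d})
      (at_right 0)"
    using f pos order_tendstoD(1)[OF ratio k'(2)] eventually_at_right_real[OF d]
    by eventually_elim simp
  then obtain b where b: "b > 0"
    and ev: "\<And>s. 0 < s \<Longrightarrow> s < b \<Longrightarrow>
      f s = exp (\<phi> s) \<and> \<phi> s > 0 \<and> \<phi> (1/2 * s) / \<phi> s > k' \<and> s \<in> {0<..<d}"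
    unfolding eventually_at_right_field by blast
  define s0 where "s0 = b / 2"
  have s0: "0 < s0" "s0 < b" using b by (auto simp: s0_def)
  define u where "u n = s0 / 2 ^ n" for n :: nat
  have u: "0 < u n" "u n \<le> s0" "u n < b" for n
  proof -
    show "0 < u n" using s0 by (simp add: u_def)
    have "s0 / 2 ^ n \<le> s0 / 1" using s0 by (intro divide_left_mono) auto
    then show "u n \<le> s0" by (simp add: u_def)
    then show "u n < b" using s0 by simp
  qed
  have geom: "\<phi> (u n) \<ge> k' ^ n * \<phi> s0" for n
  proof (induction n)
    case 0
    then show ?case by (simp add: u_def)
  next
    case (Suc n)
    have *: "\<phi> (u n) > 0" "\<phi> (1/2 * u n) / \<phi> (u n) > k'" using ev[of "u n"] u by auto
    have "k' ^ Suc n * \<phi> s0 = k' * (k' ^ n * \<phi> s0)" by simp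
    also have "\<dots> \<le> k' * \<phi> (u n)" using Suc k' by (intro mult_left_mono) auto
    also have "\<dots> \<le> \<phi> (1/2 * u n)" using * by (simp add: field_simps)
    also have "1/2 * u n = u (Suc n)" by (simp add: u_def)
    finally show ?case .
  qed
  have phi0: "\<phi> s0 > 0" using ev s0 by blast
  show ?thesis
    unfolding filterlim_at_top
  proof
    fix K :: real
    \<comment> \<open>Exceeding \<open>\<phi> s0\<close> as well as \<open>K\<close> matters:
      convexity only bounds \<open>\<phi> (u n)\<close> by the larger of \<open>\<phi> s\<close> and
      \<open>\<phi> s0\<close>, and the second alternative must be ruled out.\<close>
    obtain n where n: "max K (\<phi> s0) / \<phi> s0 < k' ^ n"
      using real_arch_pow[OF k'(1)] by blast
    have "max K (\<phi> s0) < k' ^ n * \<phi> s0"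
      using n phi0 by (simp add: field_simps)
    then have un: "max K (\<phi> s0) < \<phi> (u n)" using geom[of n] by linarith
    have "K \<le> \<phi> s" if s: "0 < s" "s < u n" for s
    proof -
      have seg: "u n \<in> closed_segment s s0"
        using s u[of n] by (simp add: closed_segment_eq_real_ivl)
      have in_d: "s \<in> {0<..<d}" "s0 \<in> {0<..<d}" using ev[of s] ev[of s0] s s0 u[of n] by auto
      obtain t where t: "0 \<le> t" "t \<le> 1" "u n = (1 - t) *\<^sub>R s + t *\<^sub>R s0"
        using seg unfolding closed_segment_def by blast
      have "f (u n) \<le> max (f s) (f s0)"
        using convex_lower[OF conv in_d, of "1 - t" t] t by simp
      then have "exp (\<phi> (u n)) \<le> max (exp (\<phi> s)) (exp (\<phi> s0))"
        using ev[of s] ev[of s0] ev[of "u n"] s s0 u[of n] by simp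
      then have "\<phi> (u n) \<le> max (\<phi> s) (\<phi> s0)" by (simp add: le_max_iff_disj)
      then show ?thesis using un by linarith
    qed
    then show "eventually (\<lambda>s. K \<le> \<phi> s) (at_right 0)"
      unfolding eventually_at_right_field using u(1)[of n] by blast
  qed
qed

text \<open>In each inequality both sides equal 1 at \<theta> = 0, and there the derivatives compare
  strictly: \<rho> < \<beta> in the first, -\<rho> < -\<alpha> in the second. Hence every small
  positive \<theta> works.\<close>

lemma exists_tilt:
  fixes \<rho> \<alpha> \<beta> :: real
  assumes "\<alpha> < \<rho>" "\<rho> < \<beta>"
  shows "\<exists>\<theta>. 0 < \<theta> \<and> \<theta> < 1 \<and> (1 - \<theta>) powr (- \<rho>) < 1 + \<theta> * \<beta> \<and> (1 + \<theta>) powr (- \<rho>) < 1 - \<theta> * \<alpha>"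
proof -
  have "((\<lambda>t. (1 + t * \<beta>) - (1 - t) powr (- \<rho>)) has_real_derivative (\<beta> - \<rho>)) (at 0)"
    by (auto intro!: derivative_eq_intros)
  from DERIV_pos_inc_right[OF this] assms
  obtain d1 where d1: "d1 > 0" "\<And>h. 0 < h \<Longrightarrow> h < d1 \<Longrightarrow> (1 - h) powr (- \<rho>) < 1 + h * \<beta>"
    by auto
  have "((\<lambda>t. (1 - t * \<alpha>) - (1 + t) powr (- \<rho>)) has_real_derivative (\<rho> - \<alpha>)) (at 0)"
    by (auto intro!: derivative_eq_intros)
  from DERIV_pos_inc_right[OF this] assms
  obtain d2 where d2: "d2 > 0" "\<And>h. 0 < h \<Longrightarrow> h < d2 \<Longrightarrow> (1 + h) powr (- \<rho>) < 1 - h * \<alpha>"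
    by auto
  define h where "h = min (min d1 d2) 1 / 2"
  have "0 < h" "h < d1" "h < d2" "h < 1" using d1(1) d2(1) by (auto simp: h_def)
  with d1(2) d2(2) show ?thesis by blast
qed

section \<open>Moment generating functions and exponential inequalities\<close>

context finite_borel_measure
begin

text \<open>This covers an infinite transform too: \<open>enn2real\<close> sends infinity to 0, and
  the Bochner integral of a non-integrable function is 0.\<close>

lemma enn2real_mgf: "enn2real (mgf M t) = (LINT x|M. exp (t * x))"
proof -
  note [measurable_cong] = M_is_borel
  show ?thesis unfolding mgf_def by (subst integral_eq_nn_integral) auto
qed

text \<open>The supremum supplies some \<open>s > t\<close> with finite transform. Then
  \<open>exp (s * x)\<close> dominates for \<open>x \<ge> 0\<close>, and the constant 1, integrable
  because the measure is finite, dominates for \<open>x < 0\<close>.\<close>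

lemma integrable_exp_below_r_star:
  assumes "r_star M = ereal r" "0 \<le> t" "t < r"
  shows "integrable M (\<lambda>x. exp (t * x))"
proof -
  note [measurable_cong] = M_is_borel
  have "ereal t < (SUP s\<in>{s. mgf M s < \<infinity>}. ereal s)"
    using assms by (simp add: r_star_def)
  then obtain s where s: "mgf M s < \<infinity>" "t < s" by (auto simp: less_SUP_iff)
  have "integrable M (\<lambda>x. exp (s * x))"
    by (rule integrableI_nonneg) (use s in \<open>auto simp: mgf_def\<close>)
  then have "integrable M (\<lambda>x. 1 + exp (s * x))" by simp
  then show ?thesis
  proof (rule Bochner_Integration.integrable_bound)
    show "AE x in M. norm (exp (t * x)) \<le> norm (1 + exp (s * x))"
    proof (rule AE_I2)
      fix x
      show "norm (exp (t * x)) \<le> norm (1 + exp (s * x))"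
      proof (cases "x \<ge> 0")
        case True
        then have "exp (t * x) \<le> exp (s * x)" using s by (simp add: mult_right_mono)
        then show ?thesis by (simp add: add_increasing)
      next
        case False
        then have "exp (t * x) \<le> 1" using assms by (simp add: mult_nonneg_nonpos)
        then show ?thesis by (simp add: add_increasing2)
      qed
    qed
  qed simp
qed

text \<open>Convexity of \<open>exp\<close> integrates. It is used both for the blow-up at 0 and for
  the continuity behind the intermediate value argument.\<close>

lemma convex_on_mgf:
  assumes "convex I" and int: "\<And>t. t \<in> I \<Longrightarrow> integrable M (\<lambda>x. exp (t * x))"
  shows "convex_on I (\<lambda>t. enn2real (mgf M t))"
proof
  fix u a b :: real
  assume u: "0 < u" "u < 1" and ab: "a \<in> I" "b \<in> I"
  then have "(1 - u) *\<^sub>R a + u *\<^sub>R b \<in> I"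
    using \<open>convex I\<close> by (intro convexD) auto
  then have "(LINT x|M. exp (((1 - u) *\<^sub>R a + u *\<^sub>R b) * x))
      \<le> (LINT x|M. (1 - u) * exp (a * x) + u * exp (b * x))"
  proof (intro integral_mono int)
    fix x
    show "exp (((1 - u) *\<^sub>R a + u *\<^sub>R b) * x) \<le> (1 - u) * exp (a * x) + u * exp (b * x)"
      using convex_onD[OF exp_convex, of u "a * x" "b * x"] u by (simp add: algebra_simps)
  qed (use ab int in auto)
  also have "\<dots> = (1 - u) * (LINT x|M. exp (a * x)) + u * (LINT x|M. exp (b * x))"
    using ab int by simp
  finally show "enn2real (mgf M ((1 - u) *\<^sub>R a + u *\<^sub>R b))
      \<le> (1 - u) * enn2real (mgf M a) + u * enn2real (mgf M b)"
    by (simp add: enn2real_mgf)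
qed fact

lemma chernoff_bound:
  assumes "integrable M (\<lambda>x. exp (t * x))" "0 \<le> t"
  shows "measure M {x..} \<le> exp (- t * x) * enn2real (mgf M t)"
proof -
  have "measure M {x..} = (LINT y|M. indicator {x..} y)"
    by (simp add: M_is_borel sets_eq_imp_space_eq[OF M_is_borel])
  also have "\<dots> \<le> (LINT y|M. exp (- t * x) * exp (t * y))"
  proof (rule integral_mono)
    fix y
    show "indicator {x..} y \<le> exp (- t * x) * exp (t * y)"
      using assms by (auto simp: indicator_def mult_left_mono simp flip: exp_add)
  qed (use assms in \<open>auto simp: M_is_borel emeasure_finite less_top[symmetric]\<close>)
  finally show ?thesis using assms by (simp add: enn2real_mgf)
qed

text \<open>Split the integral of \<open>exp (t * x)\<close> at \<open>a\<close> and
  \<open>b\<close>. Raising the tilt by \<open>h\<close> controls the part beyond \<open>b\<close>,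
  lowering it by \<open>h\<close> controls the part up to \<open>a\<close>; each costs at most a
  quarter of the total. The remaining half lives on \<open>(a, b]\<close>, where the integrand is at
  most \<open>exp (t * b)\<close>.\<close>

lemma tail_lower_bound:
  assumes int: "integrable M (\<lambda>x. exp (t * x))" "integrable M (\<lambda>x. exp ((t + h) * x))"
      "integrable M (\<lambda>x. exp ((t - h) * x))"
    and t: "0 \<le> t" "0 \<le> h"
    and up: "exp (- h * b) * enn2real (mgf M (t + h)) \<le> enn2real (mgf M t) / 4"
    and low: "exp (h * a) * enn2real (mgf M (t - h)) \<le> enn2real (mgf M t) / 4"
  shows "enn2real (mgf M t) / 2 \<le> exp (t * b) * measure M {a<..}"
proof -
  note [measurable_cong] = M_is_borel
  have ind: "integrable M (indicator {a<..} :: real \<Rightarrow> real)"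
    by (auto simp: M_is_borel emeasure_finite less_top[symmetric])
  have "(LINT x|M. exp (t * x)) \<le> (LINT x|M. exp (- h * b) * exp ((t + h) * x)
      + exp (h * a) * exp ((t - h) * x) + exp (t * b) * indicator {a<..} x)"
  proof (rule integral_mono)
    fix x
    have 1: "exp (t * x) \<le> exp (- h * b) * exp ((t + h) * x)" if "x > b"
      using that t mult_left_mono[of b x h] by (simp add: algebra_simps flip: exp_add)
    have 2: "exp (t * x) \<le> exp (h * a) * exp ((t - h) * x)" if "x \<le> a"
      using that t mult_left_mono[of x a h] by (simp add: algebra_simps flip: exp_add)
    have 3: "exp (t * x) \<le> exp (t * b) * indicator {a<..} x" if "x > a" "x \<le> b"
      using that t by (simp add: mult_left_mono)
    have pos: "0 \<le> exp (- h * b) * exp ((t + h) * x)" "0 \<le> exp (h * a) * exp ((t - h) * x)"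
      "0 \<le> exp (t * b) * (indicator {a<..} x :: real)"
      by auto
    consider "x > b" | "x \<le> a" | "x > a" "x \<le> b" by linarith
    then show "exp (t * x) \<le> exp (- h * b) * exp ((t + h) * x)
      + exp (h * a) * exp ((t - h) * x) + exp (t * b) * indicator {a<..} x"
      by cases (use 1 2 3 pos in linarith)+
  qed (use int ind in auto)
  also have "\<dots> = exp (- h * b) * (LINT x|M. exp ((t + h) * x))
      + exp (h * a) * (LINT x|M. exp ((t - h) * x)) + exp (t * b) * measure M {a<..}"
    using int ind by (simp add: sets_eq_imp_space_eq[OF M_is_borel])
  finally show ?thesis using up low by (simp add: enn2real_mgf)
qed

section \<open>Lower and upper bounds for the right tail\<close>

text \<open>The exponent is \<open>- r * b\<close>, where \<open>b = \<beta> / \<alpha> * x\<close>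
  is the right end of the window carrying half the tilted mass. The loss is thus the ratio of the
  window's ends, which can be brought as close to 1 as desired.\<close>

lemma right_tail_lower:
  assumes r: "r_star M = ereal r" "0 < r"
    and \<rho>: "0 < \<alpha>" "\<alpha> < \<rho>" "\<rho> < \<beta>" and l: "slowly_varying l"
    and asymp: "(\<lambda>s. ln (enn2real (mgf M (r - s)))) \<sim>[at_right 0] (\<lambda>s. s powr (- \<rho>) * l (1 / s))"
  shows "eventually (\<lambda>x. measure M {x<..} \<ge> exp (- r * (\<beta> / \<alpha>) * x)) at_top"
proof -
  define m where "m t = enn2real (mgf M t)" for t
  define \<phi> where "\<phi> s = ln (m (r - s))" for s
  have int: "integrable M (\<lambda>x. exp (t * x))" if "t \<in> {0<..<r}" for t
    using integrable_exp_below_r_star[OF r(1)] that by simp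
  have conv_m: "convex_on {0<..<r} m"
    unfolding m_def by (rule convex_on_mgf) (auto intro: int)
  have conv: "convex_on {0<..<r} (\<lambda>s. m (r - s))"
  proof
    fix u a b :: real
    assume "0 < u" "u < 1" "a \<in> {0<..<r}" "b \<in> {0<..<r}"
    then show "m (r - ((1 - u) *\<^sub>R a + u *\<^sub>R b)) \<le> (1 - u) * m (r - a) + u * m (r - b)"
      using convex_onD[OF conv_m, of u "r - a" "r - b"] by (simp add: algebra_simps)
  qed simp
  have \<phi>_asymp: "\<phi> \<sim>[at_right 0] (\<lambda>s. s powr (- \<rho>) * l (1 / s))"
    using asymp by (simp add: \<phi>_def[abs_def] m_def)
  note ratio = slowly_varying_asymp_ratio(1)[OF l _ \<phi>_asymp]
  have pos: "eventually (\<lambda>s. \<phi> s > 0) (at_right 0)"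
    using slowly_varying_asymp_ratio(2)[OF l zero_less_one \<phi>_asymp] .
  \<comment> \<open>Since \<open>ln 0 = 0\<close>, positivity of \<open>\<phi> s\<close> excludes
    \<open>m (r - s) = 0\<close>, including the case of an infinite transform.\<close>
  have exp_\<phi>: "m (r - s) = exp (\<phi> s)" if "\<phi> s > 0" for s
  proof -
    have "m (r - s) \<noteq> 0" using that by (auto simp: \<phi>_def)
    moreover have "m (r - s) \<ge> 0" by (simp add: m_def)
    ultimately show ?thesis by (simp add: \<phi>_def)
  qed
  have lim: "filterlim \<phi> at_top (at_right 0)"
  proof (rule filterlim_at_top_convex_doubling[OF conv r(2) _ pos ratio])
    show "eventually (\<lambda>s. m (r - s) = exp (\<phi> s)) (at_right 0)"
      using pos by eventually_elim (rule exp_\<phi>)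
    have "(2::real) powr 0 < 2 powr \<rho>" using \<rho> by (intro powr_less_mono) auto
    then show "(1 / 2) powr (- \<rho>) > (1::real)"
      by (simp add: powr_divide powr_minus)
  qed simp
  obtain \<theta> where \<theta>: "0 < \<theta>" "\<theta> < 1" "(1 - \<theta>) powr (- \<rho>) < 1 + \<theta> * \<beta>"
      "(1 + \<theta>) powr (- \<rho>) < 1 - \<theta> * \<alpha>"
    using exists_tilt \<rho> by blast
  \<comment> \<open>With \<open>h = \<theta> * s\<close> and
    \<open>s * b = \<beta> * \<phi> s\<close>, this product is the logarithm of
    \<open>m (r - s)\<close> over \<open>exp (- h * b) * m (r - s + h)\<close>. Its first factor has
    a positive limit by the choice of \<theta>, so it eventually exceeds \<open>ln 4\<close>, which
    is the quarter required by \<open>tail_lower_bound\<close>. The product treated next plays the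
    same part for the tilt lowered by \<open>h\<close>.\<close>
  have "filterlim (\<lambda>s. (1 + \<theta> * \<beta> - \<phi> ((1 - \<theta>) * s) / \<phi> s) * \<phi> s) at_top (at_right 0)"
    by (rule filterlim_tendsto_pos_mult_at_top[OF tendsto_diff[OF tendsto_const ratio] _ lim])
      (use \<theta> in auto)
  then have up: "eventually (\<lambda>s. (1 + \<theta> * \<beta> - \<phi> ((1 - \<theta>) * s) / \<phi> s) * \<phi> s \<ge> ln 4) (at_right 0)"
    by (simp add: filterlim_at_top)
  have "filterlim (\<lambda>s. (1 - \<theta> * \<alpha> - \<phi> ((1 + \<theta>) * s) / \<phi> s) * \<phi> s) at_top (at_right 0)"
    by (rule filterlim_tendsto_pos_mult_at_top[OF tendsto_diff[OF tendsto_const ratio] _ lim])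
      (use \<theta> in auto)
  then have low: "eventually (\<lambda>s. (1 - \<theta> * \<alpha> - \<phi> ((1 + \<theta>) * s) / \<phi> s) * \<phi> s \<ge> ln 4) (at_right 0)"
    by (simp add: filterlim_at_top)
  have "eventually (\<lambda>s. \<phi> s > 0 \<and> \<phi> s \<ge> ln 4 \<and>
      (1 + \<theta> * \<beta> - \<phi> ((1 - \<theta>) * s) / \<phi> s) * \<phi> s \<ge> ln 4 \<and>
      (1 - \<theta> * \<alpha> - \<phi> ((1 + \<theta>) * s) / \<phi> s) * \<phi> s \<ge> ln 4) (at_right 0)"
    using pos up low lim[unfolded filterlim_at_top, rule_format, of "ln 4"]
    by eventually_elim simp
  then obtain b0 where b0: "b0 > 0" and ev0: "\<And>s. 0 < s \<Longrightarrow> s < b0 \<Longrightarrow> \<phi> s > 0 \<and> \<phi> s \<ge> ln 4 \<and>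
      (1 + \<theta> * \<beta> - \<phi> ((1 - \<theta>) * s) / \<phi> s) * \<phi> s \<ge> ln 4 \<and>
      (1 - \<theta> * \<alpha> - \<phi> ((1 + \<theta>) * s) / \<phi> s) * \<phi> s \<ge> ln 4"
    unfolding eventually_at_right_field by blast
  \<comment> \<open>The margin of 2 keeps \<open>s + h < 2 * s\<close> below both \<open>b0\<close>
    and \<open>r\<close>, so the shifted tilts stay positive and in the range of the
    estimates.\<close>
  define s1 where "s1 = min b0 r / 4"
  have s1: "0 < s1" "2 * s1 < b0" "2 * s1 < r" using b0 r by (auto simp: s1_def)
  have key: "measure M {x<..} \<ge> exp (- r * (\<beta> / \<alpha>) * x)"
    if s: "0 < s" "s \<le> s1" and x: "\<phi> s / s = x / \<alpha>" for s x
  proof -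
    define h where "h = \<theta> * s"
    have h: "0 < h" "h < s" using \<theta> s by (auto simp: h_def)
    have "(1 - \<theta>) * s = s - h" "(1 + \<theta>) * s = s + h" by (simp_all add: h_def algebra_simps)
    then have \<phi>s: "\<phi> s > 0" "\<phi> ((1 - \<theta>) * s) > 0" "\<phi> ((1 + \<theta>) * s) > 0"
      using ev0[of s] ev0[of "s - h"] ev0[of "s + h"] h s s1 by simp_all
    have xs: "s * x = \<alpha> * \<phi> s" using x s \<rho> by (simp add: field_simps)
    have x_pos: "x > 0" using xs \<phi>s \<rho> s by (metis mult_pos_pos zero_less_mult_pos)
    define b where "b = \<beta> / \<alpha> * x"
    have bs: "s * b = \<beta> * \<phi> s" using xs \<rho> by (simp add: b_def field_simps)
    have b_pos: "b > 0" using x_pos \<rho> by (simp add: b_def)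
    have hyp: "\<phi> s \<ge> ln 4"
      "(1 + \<theta> * \<beta> - \<phi> ((1 - \<theta>) * s) / \<phi> s) * \<phi> s \<ge> ln 4"
      "(1 - \<theta> * \<alpha> - \<phi> ((1 + \<theta>) * s) / \<phi> s) * \<phi> s \<ge> ln 4"
      using ev0[of s] s s1 by auto
    have quarter: "exp (\<phi> s) / 4 = exp (\<phi> s - ln 4)" by (simp add: exp_diff)
    have m_s: "m (r - s) = exp (\<phi> s)" "m (r - s + h) = exp (\<phi> ((1 - \<theta>) * s))"
      "m (r - s - h) = exp (\<phi> ((1 + \<theta>) * s))"
      using exp_\<phi>[OF \<phi>s(1)] exp_\<phi>[OF \<phi>s(2)] exp_\<phi>[OF \<phi>s(3)] by (simp_all add: h_def algebra_simps)
    have "m (r - s) / 2 \<le> exp ((r - s) * b) * measure M {x<..}"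
      unfolding m_def
    proof (rule tail_lower_bound)
      show "exp (- h * b) * enn2real (mgf M (r - s + h)) \<le> enn2real (mgf M (r - s)) / 4"
        unfolding m_def[symmetric] m_s quarter using hyp(2) \<phi>s bs
        by (simp add: h_def mult.assoc algebra_simps flip: exp_add)
      show "exp (h * x) * enn2real (mgf M (r - s - h)) \<le> enn2real (mgf M (r - s)) / 4"
        unfolding m_def[symmetric] m_s quarter using hyp(3) \<phi>s xs
        by (simp add: h_def mult.assoc algebra_simps flip: exp_add)
    qed (use h s s1 in \<open>auto intro!: int\<close>)
    \<comment> \<open>This absorbs the factor one half, leaving a bound free of constants;
      \<open>exp (- s * b) \<le> 1\<close> is then discarded.\<close>
    moreover have "4 \<le> m (r - s)"
      unfolding m_s using hyp(1) by (metis exp_le_cancel_iff exp_ln zero_less_numeral)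
    ultimately have "1 \<le> exp ((r - s) * b) * measure M {x<..}" by linarith
    also have "\<dots> \<le> exp (r * b) * measure M {x<..}"
      using b_pos s by (intro mult_right_mono) (auto simp: algebra_simps)
    finally have "exp (- (r * b)) * 1 \<le> exp (- (r * b)) * (exp (r * b) * measure M {x<..})"
      by (intro mult_left_mono) auto
    also have "\<dots> = measure M {x<..}" by (simp add: exp_minus)
    finally show ?thesis by (simp add: b_def algebra_simps)
  qed
  have div_lim: "filterlim (\<lambda>s. \<phi> s / s) at_top (at_right 0)"
    using filterlim_at_top_mult_at_top[OF lim filterlim_inverse_at_top_right]
    by (simp add: divide_inverse)
  have cont: "continuous_on {0<..s1} (\<lambda>s. \<phi> s / s)"
  proof -
    have "continuous_on {0<..<r} (\<lambda>s. m (r - s))" by (rule convex_on_continuous[OF _ conv]) simp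
    then have "continuous_on {0<..s1} (\<lambda>s. m (r - s))"
      by (rule continuous_on_subset) (use s1 in auto)
    then show ?thesis
      unfolding \<phi>_def
    proof (intro continuous_intros ballI)
      fix s assume "s \<in> {0<..s1}"
      then show "m (r - s) \<noteq> 0" using exp_\<phi>[of s] ev0[of s] s1 by auto
    qed auto
  qed
  \<comment> \<open>Beyond this threshold \<open>x / \<alpha>\<close> is at least the value of
    \<open>\<phi> s / s\<close> at \<open>s1\<close>, while the values near 0 exceed it, so the
    level is attained in between.\<close>
  have "eventually (\<lambda>x. x \<ge> \<alpha> * (\<phi> s1 / s1)) at_top" by (rule eventually_ge_at_top)
  then show ?thesis
  proof eventually_elim
    case (elim x)
    have "eventually (\<lambda>s. x / \<alpha> \<le> \<phi> s / s \<and> s \<in> {0<..<s1}) (at_right 0)"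
      using div_lim[unfolded filterlim_at_top, rule_format, of "x / \<alpha>"]
        eventually_at_right_real[OF s1(1)]
      by eventually_elim simp
    then obtain s2 where s2: "x / \<alpha> \<le> \<phi> s2 / s2" "0 < s2" "s2 < s1"
      using eventually_happens[of _ "at_right (0::real)"] by fastforce
    have "\<exists>s. s2 \<le> s \<and> s \<le> s1 \<and> \<phi> s / s = x / \<alpha>"
    proof (rule IVT2')
      show "\<phi> s1 / s1 \<le> x / \<alpha>" using elim \<rho> by (simp add: field_simps)
      show "continuous_on {s2..s1} (\<lambda>s. \<phi> s / s)"
        by (rule continuous_on_subset[OF cont]) (use s2 in auto)
    qed (use s2 in auto)
    then obtain s where "s2 \<le> s" "s \<le> s1" "\<phi> s / s = x / \<alpha>" by blast
    then show ?case using key[of s x] s2 by simp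
  qed
qed

lemma right_tail_upper:
  assumes r: "r_star M = ereal r" "0 < r" and \<epsilon>: "0 < \<epsilon>"
  shows "eventually (\<lambda>x. measure M {x..} \<le> exp (- (r - \<epsilon>) * x)) at_top"
proof -
  \<comment> \<open>A Chernoff parameter strictly between \<open>r - \<epsilon>\<close> and
    \<open>r\<close>; the maximum keeps it nonnegative when \<epsilon> is large.\<close>
  define t where "t = max 0 (r - \<epsilon> / 2)"
  have t: "0 \<le> t" "t < r" "r - \<epsilon> < t" using assms by (auto simp: t_def)
  note int = integrable_exp_below_r_star[OF r(1) t(1,2)]
  define C where "C = enn2real (mgf M t)"
  \<comment> \<open>From here on the spare exponential rate \<open>t - (r - \<epsilon>)\<close>
    absorbs the constant \<open>C\<close>.\<close>
  have "eventually (\<lambda>x. x \<ge> C / (t - (r - \<epsilon>))) at_top" by (rule eventually_ge_at_top)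
  then show ?thesis
  proof eventually_elim
    case (elim x)
    have "C \<le> (t - (r - \<epsilon>)) * x" using elim t by (simp add: field_simps)
    also have "\<dots> \<le> exp ((t - (r - \<epsilon>)) * x)"
      using exp_ge_add_one_self[of "(t - (r - \<epsilon>)) * x"] by linarith
    finally have "exp (- t * x) * C \<le> exp (- t * x) * exp ((t - (r - \<epsilon>)) * x)"
      by (intro mult_left_mono) auto
    also have "\<dots> = exp (- (r - \<epsilon>) * x)" by (simp add: algebra_simps flip: exp_add)
    finally show ?case using chernoff_bound[OF int t(1), of x] by (simp add: C_def)
  qed
qed

text \<open>The lower bound holds for the open tail and the upper bound for the closed one, so
  anything in between is squeezed. \<open>G\<close> lets one statement serve the open right tail
  and, after reflection, the closed left tail.\<close>

lemma right_tail_asymp: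
  assumes r: "r_star M = ereal r" "0 < r"
    and \<rho>: "0 < \<rho>" and l: "slowly_varying l"
    and asymp: "(\<lambda>s. ln (enn2real (mgf M (r - s)))) \<sim>[at_right 0] (\<lambda>s. s powr (- \<rho>) * l (1 / s))"
    and G: "\<And>x. measure M {x<..} \<le> G x" "\<And>x. G x \<le> measure M {x..}"
  shows "(\<lambda>x. ln (G x)) \<sim>[at_top] (\<lambda>x. - r * x)"
proof (rule asymp_equivI'_const)
  show "- r \<noteq> 0" using r by simp
  have "eventually (\<lambda>x. dist (ln (G x) / x) (- r) < e) at_top" if e: "e > 0" for e
  proof -
    \<comment> \<open>Chosen so that \<open>r * \<kappa> = r + e / 2\<close>. Placing \<alpha> and
      \<beta> at \<rho> divided and multiplied by \<open>sqrt \<kappa>\<close> straddles \<rho> with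
      ratio exactly \<kappa>.\<close>
    define \<kappa> where "\<kappa> = 1 + e / (2 * r)"
    have \<kappa>: "\<kappa> > 1" "r * \<kappa> = r + e / 2" using e r by (auto simp: \<kappa>_def field_simps)
    have "sqrt \<kappa> > 1" using \<kappa> by simp
    then have "\<rho> / sqrt \<kappa> < \<rho>" "\<rho> < \<rho> * sqrt \<kappa>" "0 < \<rho> / sqrt \<kappa>"
      using \<rho> \<kappa> by (auto simp: field_simps)
    moreover have "\<rho> * sqrt \<kappa> / (\<rho> / sqrt \<kappa>) = \<kappa>" using \<rho> \<kappa> by simp
    ultimately have "eventually (\<lambda>x. measure M {x<..} \<ge> exp (- (r + e / 2) * x)) at_top"
      using right_tail_lower[OF r _ _ _ l asymp, of "\<rho> / sqrt \<kappa>" "\<rho> * sqrt \<kappa>"] \<kappa>(2) by simp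
    moreover have "eventually (\<lambda>x. measure M {x..} \<le> exp (- (r - e / 2) * x)) at_top"
      using right_tail_upper[OF r, of "e / 2"] e by simp
    ultimately show ?thesis
      using eventually_gt_at_top[of 0]
    proof eventually_elim
      case (elim x)
      have le: "exp (- (r + e / 2) * x) \<le> G x" "G x \<le> exp (- (r - e / 2) * x)"
        using elim G[of x] by linarith+
      have G_pos: "0 < G x" by (rule less_le_trans[OF exp_gt_zero le(1)])
      have "- (r + e / 2) * x \<le> ln (G x)" using le(1) G_pos by (simp add: ln_ge_iff)
      moreover have "ln (G x) \<le> - (r - e / 2) * x"
        using le(2) G_pos by (metis exp_gt_zero ln_exp ln_le_cancel_iff)
      ultimately have "- (r + e / 2) \<le> ln (G x) / x" "ln (G x) / x \<le> - (r - e / 2)"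
        using elim(3) by (simp_all only: pos_le_divide_eq pos_divide_le_eq)
      then show ?case using e unfolding dist_real_def by linarith
    qed
  qed
  then show "((\<lambda>x. ln (G x) / x) \<longlongrightarrow> - r) at_top" by (rule tendstoI)
qed

section \<open>Reflection in the origin, exchanging the two tails\<close>

lemma mgf_reflect: "mgf (distr M borel uminus) s = mgf M (- s)"
proof -
  note [measurable_cong] = M_is_borel
  show ?thesis unfolding mgf_def by (subst nn_integral_distr) auto
qed

text \<open>Reflection negates the set of finiteness, and the supremum of the negatives is minus the
  infimum.\<close>

lemma r_star_reflect: "r_star (distr M borel uminus) = q_star M"
proof -
  have "{s. mgf M (- s) < \<infinity>} = uminus ` {s. mgf M s < \<infinity>}"
    by (auto intro: image_eqI[of _ uminus "- s" for s])
  then have "r_star (distr M borel uminus) = (SUP s\<in>{s. mgf M s < \<infinity>}. - ereal s)"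
    unfolding r_star_def mgf_reflect by (simp only: image_image uminus_ereal.simps)
  then show ?thesis unfolding q_star_def by (simp only: ereal_SUP_uminus_eq)
qed

lemma finite_borel_measure_reflect: "finite_borel_measure (distr M borel uminus)"
proof -
  note [measurable_cong] = M_is_borel
  interpret D: finite_measure "distr M borel uminus" by (rule finite_measure_distr) simp
  show ?thesis by standard simp
qed

lemma measure_reflect:
  assumes "A \<in> sets borel"
  shows "measure (distr M borel uminus) A = measure M (uminus -` A)"
proof -
  note [measurable_cong] = M_is_borel
  show ?thesis
    using assms by (subst measure_distr) (auto simp: sets_eq_imp_space_eq[OF M_is_borel])
qed

end

theorem theorem8:
  fixes F :: "real measure" and q r :: real
  assumes "finite_borel_measure F"
    and "q_star F = ereal q" and "0 < q"
    and "r_star F = ereal r" and "0 < r"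
  shows
    "(\<forall>\<rho> l1. \<rho> > 0 \<longrightarrow> slowly_varying l1 \<longrightarrow>
        (\<lambda>s. ln (enn2real (mgf F (- q + s)))) \<sim>[at_right 0] (\<lambda>s. s powr (- \<rho>) * l1 (1 / s)) \<longrightarrow>
        (\<lambda>x. ln (measure F {..- x})) \<sim>[at_top] (\<lambda>x. - q * x)) \<and>
     (\<forall>\<rho> l1. \<rho> > 0 \<longrightarrow> slowly_varying l1 \<longrightarrow>
        (\<lambda>s. ln (enn2real (mgf F (r - s)))) \<sim>[at_right 0] (\<lambda>s. s powr (- \<rho>) * l1 (1 / s)) \<longrightarrow>
        (\<lambda>x. ln (measure F {x<..})) \<sim>[at_top] (\<lambda>x. - r * x))"
proof (intro conjI allI impI)
  interpret F: finite_borel_measure F by fact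
  interpret D: finite_borel_measure "distr F borel uminus"
    by (rule F.finite_borel_measure_reflect)
  fix \<rho> :: real and l1
  assume \<rho>: "\<rho> > 0" and l1: "slowly_varying l1"
  {
    assume asymp: "(\<lambda>s. ln (enn2real (mgf F (- q + s)))) \<sim>[at_right 0]
      (\<lambda>s. s powr (- \<rho>) * l1 (1 / s))"
    have closed: "measure F {..- x} = measure (distr F borel uminus) {x..}" for x
    proof -
      have "uminus -` {x..} = {..- x}" by auto
      then show ?thesis by (simp add: F.measure_reflect)
    qed
    show "(\<lambda>x. ln (measure F {..- x})) \<sim>[at_top] (\<lambda>x. - q * x)"
      unfolding closed
    proof (rule D.right_tail_asymp[OF _ _ \<rho> l1])
      show "r_star (distr F borel uminus) = ereal q" using assms F.r_star_reflect by simp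
      show "(\<lambda>s. ln (enn2real (mgf (distr F borel uminus) (q - s)))) \<sim>[at_right 0]
          (\<lambda>s. s powr (- \<rho>) * l1 (1 / s))"
        using asymp by (simp add: F.mgf_reflect algebra_simps)
    qed (use assms in \<open>auto intro!: D.finite_measure_mono\<close>)
  }
  {
    assume asymp: "(\<lambda>s. ln (enn2real (mgf F (r - s)))) \<sim>[at_right 0]
      (\<lambda>s. s powr (- \<rho>) * l1 (1 / s))"
    show "(\<lambda>x. ln (measure F {x<..})) \<sim>[at_top] (\<lambda>x. - r * x)"
      by (rule F.right_tail_asymp[OF assms(4,5) \<rho> l1 asymp])
        (auto intro!: F.finite_measure_mono simp: F.M_is_borel)
  }
qed

end
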